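(* Let $\mathfrak{g}$ be a (possibly infinite-dimensional) Lie algebra over $\mathbb{C}$ equipped with a non-degenerate symmetric invariant bilinear form $\langle\cdot,\cdot\rangle$, and let $p(x)\in\mathbb{C}[x]$. Set $$\hat{\mathfrak{g}}_p=(\mathfrak{g}\oplus\mathfrak{g}^1)\otimes\mathbb{C}[t,t^{-1}]\oplus\mathbb{C}\mathbf{k},$$ a vector space over $\mathbb{C}$. Define a bilinear operation $[\cdot,\cdot]$ on $\hat{\mathfrak{g}}_p$ by $[\mathbf{k},\hat{\mathfrak{g}}_p]=0=[\hat{\mathfrak{g}}_p,\mathbf{k}]$ and, for $a,b\in\mathfrak{g}$, $$[a(x_1),b(x_2)]=[a,b](x_2)x_2^{-1}\delta\left(\frac{x_1}{x_2}\right)+\langle a,b\rangle\mathbf{k}\frac{\partial}{\partial x_2}x_2^{-1}\delta\left(\frac{x_1}{x_2}\right),$$ $$[a(x_1),b^1(x_2)]=[a,b]^1(x_2)x_2^{-1}\delta\left(\frac{x_1}{x_2}\right),\qquad [a^1(x_1),b(x_2)]=[a,b]^1(x_2)x_2^{-1}\delta\left(\frac{x_1}{x_2}\right),$$ $$[a^1(x_1),b^1(x_2)]=p(x_2)[a,b](x_2)x_2^{-1}\delta\left(\frac{x_1}{x_2}\right)+\frac12\langle a,b\rangle p'(x_2)\mathbf{k}\,x_2^{-1}\delta\left(\frac{x_1}{x_2}\right)+\langle a,b\rangle p(x_2)\mathbf{k}\frac{\partial}{\partial x_2}x_2^{-1}\delta\left(\frac{x_1}{x_2}\right).$$ Then $\hat{\mathfrak{g}}_p$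 is a Lie algebra over $\mathbb{C}$.
   Context: $\mathfrak{g}^1$ is a vector space with a fixed linear isomorphism $\mathfrak{g}\to\mathfrak{g}^1$, $a\mapsto a^1$. For $u\in\mathfrak{g}\oplus\mathfrak{g}^1$, $u(x)=\sum_{n\in\mathbb{Z}}(u\otimes t^n)x^{-n-1}$. Also $x_2^{-1}\delta(x_1/x_2)=\sum_{n\in\mathbb{Z}}x_1^{n}x_2^{-n-1}=\sum_{n\in\mathbb{Z}}x_2^{n}x_1^{-n-1}$. The bracket of basis elements is read off by comparing coefficients of $x_1^{-m-1}x_2^{-n-1}$ on both sides. *)

theory Defs
  imports
    "HOL-Analysis.Product_Vector"
    "HOL-Computational_Algebra.Polynomial"
    "HOL-Library.Poly_Mapping"
    "HOL-Library.Function_Algebras"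
begin

definition bilinear_map ::
  "('k::field \<Rightarrow> 'a::ab_group_add \<Rightarrow> 'a) \<Rightarrow> ('k \<Rightarrow> 'b::ab_group_add \<Rightarrow> 'b) \<Rightarrow>
   ('k \<Rightarrow> 'c::ab_group_add \<Rightarrow> 'c) \<Rightarrow> ('a \<Rightarrow> 'b \<Rightarrow> 'c) \<Rightarrow> bool" where
  "bilinear_map s1 s2 s3 f \<longleftrightarrow>
     (\<forall>x. Vector_Spaces.linear s2 s3 (\<lambda>y. f x y)) \<and>
     (\<forall>y. Vector_Spaces.linear s1 s3 (\<lambda>x. f x y))"

locale lie_algebra = vector_space scale
  for scale :: "'k::field \<Rightarrow> 'v::ab_group_add \<Rightarrow> 'v" +
  fixes bracket :: "'v \<Rightarrow> 'v \<Rightarrow> 'v"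
  assumes bilinear: "bilinear_map scale scale scale bracket"
    and alternating: "bracket x x = 0"
    and jacobi: "bracket x (bracket y z) + bracket y (bracket z x) + bracket z (bracket x y) = 0"

definition symmetric_form :: "('v \<Rightarrow> 'v \<Rightarrow> 'k) \<Rightarrow> bool" where
  "symmetric_form form \<longleftrightarrow> (\<forall>a b. form a b = form b a)"

definition invariant_form :: "('v \<Rightarrow> 'v \<Rightarrow> 'v) \<Rightarrow> ('v \<Rightarrow> 'v \<Rightarrow> 'k) \<Rightarrow> bool" where
  "invariant_form bracket form \<longleftrightarrow> (\<forall>a b c. form (bracket a b) c = form a (bracket b c))"

definition nondegenerate_form :: "('v::zero \<Rightarrow> 'v \<Rightarrow> 'k::zero) \<Rightarrow> bool" where
  "nondegenerate_form form \<longleftrightarrow>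
     (\<forall>a. (\<forall>b. form a b = 0) \<longrightarrow> a = 0) \<and> (\<forall>b. (\<forall>a. form a b = 0) \<longrightarrow> b = 0)"

section \<open>Formal series\<close>

text \<open>
  A formal series in integral powers of one variable with coefficients in \<open>V\<close> is a function
  \<open>int \<Rightarrow> V\<close> sending \<open>n\<close> to the coefficient of the \<open>n\<close>-th power.  A series \<open>D\<close> in \<open>x1, x2\<close> is a
  function \<open>int \<Rightarrow> int \<Rightarrow> V\<close>, where \<open>D i j\<close> is the coefficient of the \<open>i\<close>-th power of \<open>x1\<close> times
  the \<open>j\<close>-th power of \<open>x2\<close>.  Addition of series is pointwise.
\<close>

definition delta :: "int \<Rightarrow> int \<Rightarrow> complex" \<comment> \<open>\<open>1/x2\<close> times the delta series of \<open>x1/x2\<close>\<close>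
  where "delta i j = (if j = - i - 1 then 1 else 0)"

definition deriv_x2 :: "(int \<Rightarrow> int \<Rightarrow> complex) \<Rightarrow> int \<Rightarrow> int \<Rightarrow> complex" where
  "deriv_x2 D i j = of_int (j + 1) * D i (j + 1)"

definition poly_series :: "complex poly \<Rightarrow> int \<Rightarrow> complex" where
  "poly_series q n = (if n < 0 then 0 else coeff q (nat n))"

text \<open>
  The two products below are Cauchy products; they are meaningful where each of the sums has
  finitely many nonzero terms (\<^const>\<open>Sum_any\<close> is \<open>0\<close> otherwise).  This is so for a polynomial
  \<open>f\<close>, respectively for \<^const>\<open>delta\<close> and its derivative as \<open>D\<close>.
\<close>

definition series_times ::
  "(complex \<Rightarrow> 'v::ab_group_add \<Rightarrow> 'v) \<Rightarrow> (int \<Rightarrow> complex) \<Rightarrow> (int \<Rightarrow> 'v) \<Rightarrow> int \<Rightarrow> 'v" where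
  "series_times s f u j = Sum_any (\<lambda>k. s (f k) (u (j - k)))"

definition times_series2 :: \<comment> \<open>\<open>u(x2) D(x1, x2)\<close>\<close>
  "(complex \<Rightarrow> 'v::ab_group_add \<Rightarrow> 'v) \<Rightarrow> (int \<Rightarrow> 'v) \<Rightarrow> (int \<Rightarrow> int \<Rightarrow> complex) \<Rightarrow>
   int \<Rightarrow> int \<Rightarrow> 'v" where
  "times_series2 s u D i j = Sum_any (\<lambda>k. s (D i (j - k)) (u k))"

definition poly_vec :: \<comment> \<open>\<open>q(x) v\<close> for a polynomial \<open>q\<close> and a vector \<open>v\<close>\<close>
  "(complex \<Rightarrow> 'v::ab_group_add \<Rightarrow> 'v) \<Rightarrow> complex poly \<Rightarrow> 'v \<Rightarrow> int \<Rightarrow> 'v" where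
  "poly_vec s q v n = s (poly_series q n) v"

definition series_bracket ::
  "('v \<Rightarrow> 'v \<Rightarrow> 'v) \<Rightarrow> (int \<Rightarrow> 'v) \<Rightarrow> (int \<Rightarrow> 'v) \<Rightarrow> int \<Rightarrow> int \<Rightarrow> 'v" where
  "series_bracket br u v i j = br (u i) (v j)"

section \<open>The vector space and the defining relations of its bracket\<close>

text \<open>
  For a vector space \<open>V\<close>, the tensor product of \<open>V\<close> with the Laurent polynomials in \<open>t\<close> is the
  space of finitely supported functions \<open>int \<Rightarrow>\<^sub>0 V\<close>; the tensor of \<open>u\<close> with the \<open>n\<close>-th power of
  \<open>t\<close> is \<open>Poly_Mapping.single n u\<close>.  Here \<open>V\<close> is the direct sum \<open>'g \<times> 'h\<close>.
\<close>

type_synonym ('g, 'h) hat = "(int \<Rightarrow>\<^sub>0 'g \<times> 'h) \<times> complex"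

definition hat_scale ::
  "(complex \<Rightarrow> 'g::ab_group_add \<Rightarrow> 'g) \<Rightarrow> (complex \<Rightarrow> 'h::ab_group_add \<Rightarrow> 'h) \<Rightarrow>
   complex \<Rightarrow> ('g, 'h) hat \<Rightarrow> ('g, 'h) hat" where
  "hat_scale s s1 c X = (Poly_Mapping.map (module_prod.scale s s1 c) (fst X), c * snd X)"

definition central :: "('g::ab_group_add, 'h::ab_group_add) hat" where
  "central = (0, 1)"

definition gen_series :: "'g::ab_group_add \<times> 'h::ab_group_add \<Rightarrow> int \<Rightarrow> ('g, 'h) hat" where
  "gen_series u i = (Poly_Mapping.single (- i - 1) u, 0)"

text \<open>
  In the following, \<open>iota\<close> is the isomorphism of the Lie algebra with its copy, so that the
  element \<open>a\<close> and its copy are \<open>(a, 0)\<close> and \<open>(0, iota a)\<close>.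
\<close>

definition defining_relations ::
  "(complex \<Rightarrow> 'g::ab_group_add \<Rightarrow> 'g) \<Rightarrow> ('g \<Rightarrow> 'g \<Rightarrow> 'g) \<Rightarrow> ('g \<Rightarrow> 'g \<Rightarrow> complex) \<Rightarrow>
   (complex \<Rightarrow> 'h::ab_group_add \<Rightarrow> 'h) \<Rightarrow> ('g \<Rightarrow> 'h) \<Rightarrow> complex poly \<Rightarrow>
   (('g, 'h) hat \<Rightarrow> ('g, 'h) hat \<Rightarrow> ('g, 'h) hat) \<Rightarrow> bool" where
  "defining_relations s lie form s1 iota p br \<longleftrightarrow>
    (let S = hat_scale s s1;
         A = (\<lambda>a. gen_series (a, 0));
         B = (\<lambda>a. gen_series (0, iota a))
     in (\<forall>X. br central X = 0 \<and> br X central = 0) \<and>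
        (\<forall>a b.
          series_bracket br (A a) (A b) =
            times_series2 S (A (lie a b)) delta +
            times_series2 S (poly_vec S [:form a b:] central) (deriv_x2 delta) \<and>
          series_bracket br (A a) (B b) = times_series2 S (B (lie a b)) delta \<and>
          series_bracket br (B a) (A b) = times_series2 S (B (lie a b)) delta \<and>
          series_bracket br (B a) (B b) =
            times_series2 S (series_times S (poly_series p) (A (lie a b))) delta +
            times_series2 S (poly_vec S (smult (form a b / 2) (pderiv p)) central) delta +
            times_series2 S (poly_vec S (smult (form a b) p) central) (deriv_x2 delta)))"

definition is_hat_bracket ::
  "(complex \<Rightarrow> 'g::ab_group_add \<Rightarrow> 'g) \<Rightarrow> ('g \<Rightarrow> 'g \<Rightarrow> 'g) \<Rightarrow> ('g \<Rightarrow> 'g \<Rightarrow> complex) \<Rightarrow>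
   (complex \<Rightarrow> 'h::ab_group_add \<Rightarrow> 'h) \<Rightarrow> ('g \<Rightarrow> 'h) \<Rightarrow> complex poly \<Rightarrow>
   (('g, 'h) hat \<Rightarrow> ('g, 'h) hat \<Rightarrow> ('g, 'h) hat) \<Rightarrow> bool" where
  "is_hat_bracket s lie form s1 iota p br \<longleftrightarrow>
     bilinear_map (hat_scale s s1) (hat_scale s s1) (hat_scale s s1) br \<and>
     defining_relations s lie form s1 iota p br"

end

(*
  Comparing coefficients turns the relations into brackets of modes.  They say that the algebra is
  the central extension of the tensor product of g with the commutative algebra
  R = C[t, 1/t] + C[t, 1/t] theta, theta^2 = p(t), with a^1 corresponding to a theta, by the cocycle
  (a f, b g) |-> <a,b> psi(f, g), where psi(t^m, t^n) = m [m + n = 0],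
  psi(theta t^m, theta t^n) = (m - n)/2 p_{-m-n}, and psi vanishes on mixed pairs.  Such an
  extension is a Lie algebra because psi is antisymmetric and the cyclic sum of psi(f, g h)
  vanishes, while <a,[b,c]> is invariant under cyclic permutations.
*)
theory Submission
  imports Defs
begin

section \<open>Linear extension over finitely supported functions\<close>

definition keys_sum_map ::
  "('i \<Rightarrow> 'a::comm_monoid_add \<Rightarrow> 'b::comm_monoid_add) \<Rightarrow> ('i \<Rightarrow>\<^sub>0 'a) \<Rightarrow> 'b" where
  "keys_sum_map f X = (\<Sum>n\<in>Poly_Mapping.keys X. f n (Poly_Mapping.lookup X n))"

text \<open>Terms outside the support are \<open>f n 0 = 0\<close>, so mappings with different
  supports can be summed over one common index set.\<close>

lemma keys_sum_map_superset:
  assumes "finite A" "Poly_Mapping.keys X \<subseteq> A" "\<And>n. f n 0 = 0"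
  shows "keys_sum_map f X = (\<Sum>n\<in>A. f n (Poly_Mapping.lookup X n))"
  unfolding keys_sum_map_def using assms
  by (intro sum.mono_neutral_left) (auto simp: in_keys_iff)

lemma keys_sum_map_add:
  assumes "\<And>n. f n 0 = 0" "\<And>n x y. f n (x + y) = f n x + f n y"
  shows "keys_sum_map f (X + Y) = keys_sum_map f X + keys_sum_map f Y"
proof -
  let ?A = "Poly_Mapping.keys X \<union> Poly_Mapping.keys Y"
  have "keys_sum_map f Z = (\<Sum>n\<in>?A. f n (Poly_Mapping.lookup Z n))"
    if "Poly_Mapping.keys Z \<subseteq> ?A" for Z
    using that assms(1) by (intro keys_sum_map_superset) auto
  then show ?thesis
    by (simp add: Poly_Mapping.keys_add lookup_add assms(2) sum.distrib)
qed

lemma keys_sum_map_single: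
  assumes "\<And>n. f n 0 = 0"
  shows "keys_sum_map f (Poly_Mapping.single n v) = f n v"
proof -
  have "keys_sum_map f (Poly_Mapping.single n v) =
      (\<Sum>k\<in>{n}. f k (Poly_Mapping.lookup (Poly_Mapping.single n v) k))"
    using assms by (intro keys_sum_map_superset) auto
  then show ?thesis by simp
qed

lemma poly_mapping_single_induct [case_names add single]:
  assumes "\<And>X Y. P X \<Longrightarrow> P Y \<Longrightarrow> P (X + Y)" "\<And>n v. P (Poly_Mapping.single n v)"
  shows "P (X :: 'i \<Rightarrow>\<^sub>0 'a::comm_monoid_add)"
proof (induction X rule: update_induct)
  case const
  show ?case using assms(2)[of undefined 0] by simp
next
  case (update f a b)
  \<comment> \<open>The key \<open>a\<close> is new, so overwriting its entry 0 by \<open>b\<close>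
    amounts to adding \<open>b\<close> there.\<close>
  have "Poly_Mapping.update a b f = f + Poly_Mapping.single a b"
    using update.hyps(1)
    by (intro poly_mapping_eqI) (auto simp: lookup_update lookup_add lookup_single in_keys_iff when_def)
  then show ?case using assms update.IH by simp
qed


section \<open>Coefficients of the defining relations\<close>

lemma poly_series_const: "poly_series [:c:] n = (if n = 0 then c else 0)"
  by (auto simp: poly_series_def coeff_pCons split: nat.split)

lemma poly_series_pderiv: "poly_series (pderiv q) n = of_int (n + 1) * poly_series q (n + 1)"
proof (cases "n < 0")
  case True
  \<comment> \<open>At \<open>n = - 1\<close> the right side contains the constant coefficient of
    \<open>q\<close>, but its factor \<open>n + 1\<close> is zero.\<close>
  then show ?thesis by (cases "n = - 1") (auto simp: poly_series_def)
next
  case False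
  then have "nat (n + 1) = Suc (nat n)" "of_nat (Suc (nat n)) = (of_int (n + 1) :: complex)"
    by (auto simp: of_nat_nat)
  with False show ?thesis
    by (simp add: poly_series_def coeff_pderiv del: of_nat_Suc)
qed

lemma poly_series_smult: "poly_series (smult c q) n = c * poly_series q n"
  by (simp add: poly_series_def)

text \<open>Only the \<open>k\<close> with \<open>j - k = - i - 1\<close> contributes to the Cauchy
  product.\<close>

lemma times_series2_delta:
  fixes s :: "complex \<Rightarrow> 'v::ab_group_add \<Rightarrow> 'v"
  assumes "vector_space s"
  shows "times_series2 s u delta i j = u (i + j + 1)"
proof -
  interpret vector_space s by fact
  have "times_series2 s u delta i j = Sum_any (\<lambda>k. u k when k = i + j + 1)"
    unfolding times_series2_def delta_def by (rule Sum_any.cong) (auto simp: when_def)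
  then show ?thesis by simp
qed

text \<open>Differentiation moves the single contributing index to \<open>k = i + j + 2\<close> and
  leaves the factor \<open>j - k + 1 = - i - 1\<close>. At \<open>i = - m - 1\<close> this is the
  factor \<open>m\<close> of the affine cocycle.\<close>

lemma times_series2_deriv_delta:
  fixes s :: "complex \<Rightarrow> 'v::ab_group_add \<Rightarrow> 'v"
  assumes "vector_space s"
  shows "times_series2 s u (deriv_x2 delta) i j = s (of_int (- i - 1)) (u (i + j + 2))"
proof -
  interpret vector_space s by fact
  have "times_series2 s u (deriv_x2 delta) i j =
      Sum_any (\<lambda>k. s (of_int (- i - 1)) (u k) when k = i + j + 2)"
    unfolding times_series2_def delta_def deriv_x2_def
    by (rule Sum_any.cong) (auto simp: when_def)
  then show ?thesis by simp
qed

lemma series_times_poly: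
  fixes s :: "complex \<Rightarrow> 'v::ab_group_add \<Rightarrow> 'v"
  assumes "vector_space s"
  shows "series_times s (poly_series q) u j =
    (\<Sum>k\<le>degree q. s (coeff q k) (u (j - int k)))"
proof -
  interpret vector_space s by fact
  \<comment> \<open>\<open>Sum_any\<close> has its intended value only on a finite support, which
    this inclusion supplies.\<close>
  have "{k. s (poly_series q k) (u (j - k)) \<noteq> 0} \<subseteq> int ` {..degree q}"
  proof
    fix k assume "k \<in> {k. s (poly_series q k) (u (j - k)) \<noteq> 0}"
    then have "k \<ge> 0" "nat k \<le> degree q"
      by (auto simp: poly_series_def split: if_splits intro: le_degree)
    then show "k \<in> int ` {..degree q}" by (intro image_eqI[of _ _ "nat k"]) auto
  qed
  then have "series_times s (poly_series q) u j =
      (\<Sum>k\<in>int ` {..degree q}. s (poly_series q k) (u (j - k)))"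
    unfolding series_times_def by (intro Sum_any.expand_superset) auto
  also have "\<dots> = (\<Sum>k\<le>degree q. s (coeff q k) (u (j - int k)))"
    by (subst sum.reindex) (auto simp: poly_series_def)
  finally show ?thesis .
qed

section \<open>Modes of the generating series and the relations between them\<close>

locale hat_setting = lie_algebra scale lie + V1: vector_space scale1
  for scale :: "complex \<Rightarrow> 'g::ab_group_add \<Rightarrow> 'g"
    and lie :: "'g \<Rightarrow> 'g \<Rightarrow> 'g"
    and scale1 :: "complex \<Rightarrow> 'h::ab_group_add \<Rightarrow> 'h" +
  fixes form :: "'g \<Rightarrow> 'g \<Rightarrow> complex"
    and iota :: "'g \<Rightarrow> 'h"
    and p :: "complex poly"
  assumes form_bilinear: "bilinear_map scale scale (*) form"
    and form_symmetric: "symmetric_form form"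
    and form_invariant: "invariant_form lie form"
    and iota_linear: "Vector_Spaces.linear scale scale1 iota"
    and iota_bij: "bij iota"
begin

abbreviation "S \<equiv> hat_scale scale scale1"

text \<open>Even and odd refer to the degree in theta. The grading introduces no signs: the bracket
  is an ordinary Lie bracket.\<close>

definition even_gen :: "int \<Rightarrow> 'g \<Rightarrow> ('g, 'h) hat"
  where "even_gen n a = (Poly_Mapping.single n (a, 0), 0)"

definition odd_gen :: "int \<Rightarrow> 'g \<Rightarrow> ('g, 'h) hat"
  where "odd_gen n a = (Poly_Mapping.single n (0, iota a), 0)"

definition cent :: "complex \<Rightarrow> ('g, 'h) hat"
  where "cent c = (0, c)"

text \<open>\<open>even_p n a\<close> is \<open>a\<close> tensored with \<open>t^n p(t)\<close>, and \<open>odd_p n a\<close> is its copy.\<close>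

definition even_p :: "int \<Rightarrow> 'g \<Rightarrow> ('g, 'h) hat"
  where "even_p n a = (\<Sum>k\<le>degree p. S (coeff p k) (even_gen (n + int k) a))"

definition odd_p :: "int \<Rightarrow> 'g \<Rightarrow> ('g, 'h) hat"
  where "odd_p n a = (\<Sum>k\<le>degree p. S (coeff p k) (odd_gen (n + int k) a))"

lemma iota_simps: "iota (x + y) = iota x + iota y" "iota (scale c x) = scale1 c (iota x)"
  using iota_linear by (auto simp: Vector_Spaces.linear_iff)

lemma iota_0: "iota 0 = 0"
  using iota_simps(2)[of 0 0] by simp

lemma lie_simps:
  "lie (x + y) z = lie x z + lie y z" "lie z (x + y) = lie z x + lie z y"
  "lie (scale c x) z = scale c (lie x z)" "lie z (scale c x) = scale c (lie z x)"
  using bilinear by (auto simp: bilinear_map_def Vector_Spaces.linear_iff)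

lemma form_simps:
  "form (x + y) z = form x z + form y z" "form z (x + y) = form z x + form z y"
  "form (scale c x) z = c * form x z" "form z (scale c x) = c * form z x"
  using form_bilinear by (auto simp: bilinear_map_def Vector_Spaces.linear_iff)

lemma lie_skew: "lie x y + lie y x = 0"
proof -
  have "lie (x + y) (x + y) = lie x x + lie y x + (lie x y + lie y y)"
    by (simp only: lie_simps)
  then show ?thesis by (simp add: alternating add.commute)
qed

text \<open>Invariance combined with symmetry. It gives the central terms of a Jacobi sum one common
  factor.\<close>

lemma form_lie_cyclic: "form b (lie c a) = form a (lie b c)" "form c (lie a b) = form a (lie b c)"
  using form_symmetric form_invariant unfolding symmetric_form_def invariant_form_def by metis+

lemma prod_scale: "module_prod.scale scale scale1 c v = (scale c (fst v), scale1 c (snd v))"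
  by (intro module_prod.scale_def) (unfold_locales)

text \<open>\<open>Poly_Mapping.map\<close> acts on nonzero entries only, which is harmless because
  scaling fixes zero.\<close>

lemma lookup_hat_scale: "Poly_Mapping.lookup (fst (S c X)) n =
    (scale c (fst (Poly_Mapping.lookup (fst X) n)), scale1 c (snd (Poly_Mapping.lookup (fst X) n)))"
  by (simp add: hat_scale_def map.rep_eq prod_scale when_def zero_prod_def)

lemma snd_hat_scale: "snd (S c X) = c * snd X"
  by (simp add: hat_scale_def)

lemma hat_eqI:
  assumes "\<And>n. Poly_Mapping.lookup (fst X) n = Poly_Mapping.lookup (fst Y) n" "snd X = snd Y"
  shows "X = (Y :: ('g, 'h) hat)"
  using assms by (auto intro: prod_eqI poly_mapping_eqI)

lemmas hat_simps = lookup_hat_scale snd_hat_scale lookup_add lookup_single when_def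
  even_gen_def odd_gen_def cent_def central_def iota_simps iota_0

lemma vector_space_hat: "vector_space S"
  by unfold_locales
    (auto intro!: hat_eqI simp: hat_simps algebra_simps scale_right_distrib scale_left_distrib
      V1.scale_right_distrib V1.scale_left_distrib)

sublocale hat: vector_space S
  by (rule vector_space_hat)

lemma gen_simps:
  "even_gen n (a + b) = even_gen n a + even_gen n b" "even_gen n (scale c a) = S c (even_gen n a)"
  "odd_gen n (a + b) = odd_gen n a + odd_gen n b" "odd_gen n (scale c a) = S c (odd_gen n a)"
  "cent (c + d) = cent c + cent d" "cent (c * d) = S c (cent d)"
  "even_gen n 0 = 0" "odd_gen n 0 = 0" "cent 0 = 0"
  by (rule hat_eqI; auto simp: hat_simps zero_prod_def algebra_simps)+

lemma gen_p_simps: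
  "even_p n (a + b) = even_p n a + even_p n b" "even_p n (scale c a) = S c (even_p n a)"
  "odd_p n (a + b) = odd_p n a + odd_p n b" "odd_p n (scale c a) = S c (odd_p n a)"
  "even_p n 0 = 0" "odd_p n 0 = 0"
  by (simp_all add: even_p_def odd_p_def gen_simps hat.scale_right_distrib sum.distrib
      hat.scale_sum_right mult.commute)

lemma cent_eq_scale: "cent c = S c central"
  by (auto intro!: hat_eqI simp: hat_simps zero_prod_def)

lemma gen_series_mode:
  "gen_series (a, 0) (- m - 1) = even_gen m a" "gen_series (0, iota a) (- m - 1) = odd_gen m a"
  by (simp_all add: gen_series_def even_gen_def odd_gen_def)

lemma gen_series_coeff:
  "gen_series (a, 0) i = even_gen (- i - 1) a" "gen_series (0, iota a) i = odd_gen (- i - 1) a"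
  by (simp_all add: gen_series_def even_gen_def odd_gen_def)

lemma poly_vec_central: "poly_vec S q central n = cent (poly_series q n)"
  by (simp add: poly_vec_def cent_eq_scale)

text \<open>Multiplying by the \<open>k\<close>-th power of x replaces the coefficient at
  \<open>j\<close> by the one at \<open>j - k\<close>, whose mode is
  \<open>(- j - 1) + k\<close>.\<close>

lemma series_times_even_gen:
  "series_times S (poly_series p) (gen_series (a, 0)) j = even_p (- j - 1) a"
  by (simp add: series_times_poly[OF vector_space_hat] gen_series_coeff even_p_def algebra_simps)

definition mode_relations :: "(('g, 'h) hat \<Rightarrow> ('g, 'h) hat \<Rightarrow> ('g, 'h) hat) \<Rightarrow> bool" where
  "mode_relations br \<longleftrightarrow>
    (\<forall>X. br central X = 0 \<and> br X central = 0) \<and>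
    (\<forall>a b m n.
      br (even_gen m a) (even_gen n b) =
        even_gen (m + n) (lie a b) + cent (if m + n = 0 then of_int m * form a b else 0) \<and>
      br (even_gen m a) (odd_gen n b) = odd_gen (m + n) (lie a b) \<and>
      br (odd_gen m a) (even_gen n b) = odd_gen (m + n) (lie a b) \<and>
      br (odd_gen m a) (odd_gen n b) =
        even_p (m + n) (lie a b) +
        cent (of_int (m - n) / 2 * form a b * poly_series p (- m - n)))"

text \<open>The substitution of \<open>- m - 1\<close> for an exponent is an involution of the
  integers, so no coefficient is missed.\<close>

lemma fun_eq_modes: "f = g \<longleftrightarrow> (\<forall>m n. f (- m - 1) (- n - 1) = g (- m - 1) (- n - 1))"
  for f g :: "int \<Rightarrow> int \<Rightarrow> 'z"
proof
  assume *: "\<forall>m n. f (- m - 1) (- n - 1) = g (- m - 1) (- n - 1)"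
  show "f = g"
  proof (intro ext)
    fix i j show "f i j = g i j" using *[rule_format, of "- i - 1" "- j - 1"] by simp
  qed
qed simp

lemma series_bracket_modes:
  "series_bracket br u v (- m - 1) (- n - 1) = br (u (- m - 1)) (v (- n - 1))"
  by (simp add: series_bracket_def)

lemma defining_relations_iff:
  "defining_relations scale lie form scale1 iota p br \<longleftrightarrow> mode_relations br"
proof -
  \<comment> \<open>The constant polynomial is evaluated at the index
    \<open>i + j + 2 = - m - n\<close>, which forces \<open>m + n = 0\<close>.\<close>
  have ee: "(times_series2 S (gen_series (lie a b, 0)) delta +
      times_series2 S (poly_vec S [:form a b:] central) (deriv_x2 delta)) (- m - 1) (- n - 1) =
      even_gen (m + n) (lie a b) + cent (if m + n = 0 then of_int m * form a b else 0)" for a b m n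
    by (auto simp: times_series2_delta[OF vector_space_hat]
        times_series2_deriv_delta[OF vector_space_hat] poly_vec_central
        gen_series_coeff poly_series_const gen_simps add.commute)
  have eo: "times_series2 S (gen_series (0, iota (lie a b))) delta (- m - 1) (- n - 1) =
      odd_gen (m + n) (lie a b)" for a b m n
    by (simp add: times_series2_delta[OF vector_space_hat] gen_series_coeff add.commute)
  \<comment> \<open>The term with p' contributes -(m + n)/2 and the derivative of delta contributes
    m; together they give (m - n)/2.\<close>
  have "cent (form a b / 2 * of_int (- m - n) * poly_series p (- m - n)) +
      cent (of_int m * (form a b * poly_series p (- m - n))) =
      cent (of_int (m - n) / 2 * form a b * poly_series p (- m - n))" for a b m n
    unfolding gen_simps(5)[symmetric] by (rule arg_cong[of _ _ cent]) (simp add: field_simps)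
  then have oo: "(times_series2 S (series_times S (poly_series p) (gen_series (lie a b, 0))) delta +
      times_series2 S (poly_vec S (smult (form a b / 2) (pderiv p)) central) delta +
      times_series2 S (poly_vec S (smult (form a b) p) central) (deriv_x2 delta))
        (- m - 1) (- n - 1) =
      even_p (m + n) (lie a b) + cent (of_int (m - n) / 2 * form a b * poly_series p (- m - n))"
    for a b m n
    by (simp add: times_series2_delta[OF vector_space_hat]
        times_series2_deriv_delta[OF vector_space_hat] poly_vec_central
        series_times_even_gen poly_series_pderiv poly_series_smult gen_simps(6)[symmetric]
        add.assoc mult.assoc)
  show ?thesis
    unfolding defining_relations_def Let_def fun_eq_modes ee eo oo mode_relations_def
      series_bracket_modes gen_series_mode
    by blast
qed

section \<open>Existence and uniqueness of the bracket\<close>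

text \<open>The generators span, and closure under sums suffices because scalar multiples of
  generators are again generators.\<close>

lemma hat_induct [case_names add even odd cent]:
  assumes "\<And>X Y. P X \<Longrightarrow> P Y \<Longrightarrow> P (X + Y)" "\<And>n a. P (even_gen n a)" "\<And>n a. P (odd_gen n a)"
    "\<And>c. P (cent c)"
  shows "P X"
proof -
  have "P (Z, 0)" for Z
  proof (induction Z rule: poly_mapping_single_induct)
    case (add Y Z)
    then show ?case using assms(1)[of "(Y, 0)" "(Z, 0)"] by simp
  next
    case (single n v)
    obtain b where b: "snd v = iota b" using iota_bij by (meson bij_pointE)
    have "(Poly_Mapping.single n v, 0) = even_gen n (fst v) + odd_gen n b"
      using b by (intro hat_eqI prod_eqI) (auto simp: hat_simps)
    then show ?case using assms by simp
  qed
  then have "P ((fst X, 0) + cent (snd X))" using assms by blast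
  then show ?thesis by (simp add: cent_def)
qed

text \<open>The four mode relations are merged into one map, biadditive in \<open>u\<close> and
  \<open>v\<close>, so that it extends along \<open>keys_sum_map\<close>.\<close>

definition mode_bracket :: "int \<Rightarrow> int \<Rightarrow> 'g \<times> 'h \<Rightarrow> 'g \<times> 'h \<Rightarrow> ('g, 'h) hat" where
  "mode_bracket m n u v =
    (let a = fst u; a1 = inv iota (snd u); b = fst v; b1 = inv iota (snd v) in
      even_gen (m + n) (lie a b) + cent (if m + n = 0 then of_int m * form a b else 0) +
      odd_gen (m + n) (lie a b1) + odd_gen (m + n) (lie a1 b) +
      (even_p (m + n) (lie a1 b1) +
       cent (of_int (m - n) / 2 * form a1 b1 * poly_series p (- m - n))))"

text \<open>The central components of the arguments are ignored, which makes \<open>central\<close>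
  bracket to zero with everything.\<close>

definition hat_bracket :: "('g, 'h) hat \<Rightarrow> ('g, 'h) hat \<Rightarrow> ('g, 'h) hat" where
  "hat_bracket X Y =
    keys_sum_map (\<lambda>m u. keys_sum_map (\<lambda>n v. mode_bracket m n u v) (fst Y)) (fst X)"


lemma inv_iota_simps:
  "inv iota (iota a) = a" "inv iota (x + y) = inv iota x + inv iota y"
  "inv iota (scale1 c x) = scale c (inv iota x)" "inv iota 0 = 0"
proof -
  have inj: "inj iota" and surj: "surj iota" using iota_bij by (auto simp: bij_def)
  show *: "inv iota (iota a) = a" for a using inj by simp
  show "inv iota (x + y) = inv iota x + inv iota y"
    by (metis * surj surj_f_inv_f iota_simps(1))
  show "inv iota (scale1 c x) = scale c (inv iota x)"
    by (metis * surj surj_f_inv_f iota_simps(2))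
  show "inv iota 0 = 0" using *[of 0] by (simp add: iota_0)
qed

lemma lie_form_0: "lie 0 x = 0" "lie x 0 = 0" "form 0 x = 0" "form x 0 = 0"
  using lie_simps(3)[of 0] lie_simps(4)[of _ 0] form_simps(3)[of 0] form_simps(4)[of _ 0] by auto

lemma mode_bracket_add:
  "mode_bracket m n (u + u') v = mode_bracket m n u v + mode_bracket m n u' v"
  "mode_bracket m n u (v + v') = mode_bracket m n u v + mode_bracket m n u v'"
  by (simp_all add: mode_bracket_def Let_def inv_iota_simps lie_simps form_simps gen_simps
      gen_p_simps distrib_left distrib_right add_divide_distrib)

lemma mode_bracket_scale:
  "mode_bracket m n (scale c (fst u), scale1 c (snd u)) v = S c (mode_bracket m n u v)"
  "mode_bracket m n u (scale c (fst v), scale1 c (snd v)) = S c (mode_bracket m n u v)"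
  by (simp_all add: mode_bracket_def Let_def inv_iota_simps lie_simps form_simps gen_simps
      gen_p_simps hat.scale_right_distrib mult.left_commute mult.assoc
      del: times_divide_eq_left times_divide_eq_right)

lemma mode_bracket_0: "mode_bracket m n 0 v = 0" "mode_bracket m n u 0 = 0"
  by (simp_all add: mode_bracket_def Let_def inv_iota_simps lie_form_0 gen_simps gen_p_simps)

lemma keys_sum_map_hat_scale:
  assumes "\<And>n. f n 0 = 0" "\<And>n v. f n (scale c (fst v), scale1 c (snd v)) = S c (f n v)"
  shows "keys_sum_map f (fst (S c X)) = S c (keys_sum_map f (fst X))"
proof -
  \<comment> \<open>Scaling by \<open>c = 0\<close> shrinks the support, so the sum is kept over the
    keys of \<open>X\<close>.\<close>
  have "keys_sum_map f (fst (S c X)) =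
      (\<Sum>n\<in>Poly_Mapping.keys (fst X). f n (Poly_Mapping.lookup (fst (S c X)) n))"
    using assms(1)
    by (intro keys_sum_map_superset) (auto simp: in_keys_iff lookup_hat_scale zero_prod_def)
  then show ?thesis
    by (simp add: lookup_hat_scale assms(2) keys_sum_map_def hat.scale_sum_right)
qed

lemma hat_bracket_bilinear: "bilinear_map S S S hat_bracket"
proof -
  \<comment> \<open>As a function of \<open>u\<close>, the inner sum must itself be linear before
    the outer sum can be treated as a linear extension.\<close>
  have inner_add: "keys_sum_map (\<lambda>n. mode_bracket m n (u + u')) Y =
      keys_sum_map (\<lambda>n. mode_bracket m n u) Y + keys_sum_map (\<lambda>n. mode_bracket m n u') Y"
    for m u u' Y
    by (simp add: keys_sum_map_def mode_bracket_add sum.distrib)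
  have inner_scale: "keys_sum_map (\<lambda>n. mode_bracket m n (scale c (fst u), scale1 c (snd u))) Y =
      S c (keys_sum_map (\<lambda>n. mode_bracket m n u) Y)" for m u c Y
    by (simp add: keys_sum_map_def mode_bracket_scale hat.scale_sum_right)
  have inner_0: "keys_sum_map (\<lambda>n. mode_bracket m n 0) Y = 0" for m Y
    by (simp add: keys_sum_map_def mode_bracket_0)
  have right_add: "hat_bracket X (Y + Z) = hat_bracket X Y + hat_bracket X Z" for X Y Z
    by (simp add: hat_bracket_def keys_sum_map_add mode_bracket_add mode_bracket_0)
      (simp add: keys_sum_map_def sum.distrib)
  have right_scale: "hat_bracket X (S c Y) = S c (hat_bracket X Y)" for X Y c
    by (simp add: hat_bracket_def keys_sum_map_hat_scale mode_bracket_scale mode_bracket_0)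
      (simp add: keys_sum_map_def hat.scale_sum_right)
  have left_add: "hat_bracket (X + Y) Z = hat_bracket X Z + hat_bracket Y Z" for X Y Z
    by (simp add: hat_bracket_def keys_sum_map_add inner_add inner_0)
  have left_scale: "hat_bracket (S c X) Y = S c (hat_bracket X Y)" for X Y c
    by (simp add: hat_bracket_def keys_sum_map_hat_scale inner_scale inner_0)
  show ?thesis
    by (simp add: bilinear_map_def Vector_Spaces.linear_iff hat.vector_space_axioms
        left_add left_scale right_add right_scale)
qed

lemma hat_bracket_gen:
  "hat_bracket (even_gen m a) (even_gen n b) = mode_bracket m n (a, 0) (b, 0)"
  "hat_bracket (even_gen m a) (odd_gen n b) = mode_bracket m n (a, 0) (0, iota b)"
  "hat_bracket (odd_gen m a) (even_gen n b) = mode_bracket m n (0, iota a) (b, 0)"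
  "hat_bracket (odd_gen m a) (odd_gen n b) = mode_bracket m n (0, iota a) (0, iota b)"
  by (simp_all add: even_gen_def odd_gen_def hat_bracket_def keys_sum_map_single mode_bracket_0)

lemma hat_bracket_mode_relations: "mode_relations hat_bracket"
proof -
  have "hat_bracket central X = 0" "hat_bracket X central = 0" for X
    by (simp_all add: hat_bracket_def central_def keys_sum_map_def)
  then show ?thesis
    unfolding mode_relations_def hat_bracket_gen
    by (simp add: mode_bracket_def Let_def inv_iota_simps lie_form_0 gen_simps gen_p_simps)
qed

lemma is_hat_bracket_hat_bracket: "is_hat_bracket scale lie form scale1 iota p hat_bracket"
  by (simp add: is_hat_bracket_def hat_bracket_bilinear defining_relations_iff
      hat_bracket_mode_relations)

end

section \<open>Consequences of the relations for an arbitrary bracket, and its uniqueness\<close>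

locale hat_bracket_setting = hat_setting scale lie scale1 form iota p
  for scale :: "complex \<Rightarrow> 'g::ab_group_add \<Rightarrow> 'g"
    and lie :: "'g \<Rightarrow> 'g \<Rightarrow> 'g"
    and scale1 :: "complex \<Rightarrow> 'h::ab_group_add \<Rightarrow> 'h"
    and form :: "'g \<Rightarrow> 'g \<Rightarrow> complex"
    and iota :: "'g \<Rightarrow> 'h"
    and p :: "complex poly" +
  fixes br :: "('g, 'h) hat \<Rightarrow> ('g, 'h) hat \<Rightarrow> ('g, 'h) hat"
  assumes is_hat_bracket: "is_hat_bracket scale lie form scale1 iota p br"
begin

lemma br_bilinear: "bilinear_map S S S br"
  using is_hat_bracket by (simp add: is_hat_bracket_def)

lemma br_simps:
  "br (X + Y) Z = br X Z + br Y Z" "br Z (X + Y) = br Z X + br Z Y"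
  "br (S c X) Z = S c (br X Z)" "br Z (S c X) = S c (br Z X)"
  using br_bilinear unfolding bilinear_map_def Vector_Spaces.linear_iff by blast+

lemma br_0: "br 0 X = 0" "br X 0 = 0"
  using br_simps(3)[of 0] br_simps(4)[of _ 0] by auto

lemma br_sum_right: "br X (sum f A) = (\<Sum>k\<in>A. br X (f k))"
  by (induction A rule: infinite_finite_induct) (simp_all add: br_0 br_simps)

lemma mode_relations_br: "mode_relations br"
  using is_hat_bracket by (simp add: is_hat_bracket_def defining_relations_iff)

lemma br_cent: "br (cent c) X = 0" "br X (cent c) = 0"
proof -
  have "br central X = 0" "br X central = 0"
    using mode_relations_br unfolding mode_relations_def by blast+
  then show "br (cent c) X = 0" "br X (cent c) = 0"
    by (simp_all add: cent_eq_scale br_simps)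
qed

lemma br_gen:
  "br (even_gen m a) (even_gen n b) =
    even_gen (m + n) (lie a b) + cent (if m + n = 0 then of_int m * form a b else 0)"
  "br (even_gen m a) (odd_gen n b) = odd_gen (m + n) (lie a b)"
  "br (odd_gen m a) (even_gen n b) = odd_gen (m + n) (lie a b)"
  "br (odd_gen m a) (odd_gen n b) =
    even_p (m + n) (lie a b) + cent (of_int (m - n) / 2 * form a b * poly_series p (- m - n))"
  using mode_relations_br unfolding mode_relations_def by blast+

text \<open>Two odd modes bracket to an \<open>even_p\<close> term, so nested brackets require the
  action on such terms. No central term arises, since psi vanishes on mixed pairs.\<close>

lemma br_odd_even_p: "br (odd_gen m a) (even_p n b) = odd_p (m + n) (lie a b)"
  by (simp add: even_p_def odd_p_def br_sum_right br_simps br_gen add.assoc)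

text \<open>Only \<open>k = - N\<close> can contribute. For \<open>N > 0\<close> there is no such
  \<open>k\<close>, and for \<open>- N\<close> above the degree the coefficient is zero.\<close>

lemma sum_coeff_delta:
  "(\<Sum>k\<le>degree p. coeff p k * (if N + int k = 0 then c else 0)) = poly_series p (- N) * c"
proof (cases "N > 0")
  case False
  have "(\<Sum>k\<le>degree p. coeff p k * (if N + int k = 0 then c else 0)) =
      (\<Sum>k\<le>degree p. if k = nat (- N) then coeff p k * c else 0)"
    using False by (intro sum.cong) auto
  also have "\<dots> = coeff p (nat (- N)) * c"
    by (simp add: coeff_eq_0)
  finally show ?thesis using False by (simp add: poly_series_def)
qed (simp add: poly_series_def)

lemma cent_sum: "cent (sum f A) = (\<Sum>k\<in>A. cent (f k))"
  by (induction A rule: infinite_finite_induct) (simp_all add: gen_simps)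

text \<open>The cocycle pairs t^m only with the term of t^n p(t) of exponent -m, whence psi(t^m, t^n
  p) = m p_{-m-n}.\<close>

lemma br_even_even_p:
  "br (even_gen m a) (even_p n b) =
    even_p (m + n) (lie a b) + cent (of_int m * form a b * poly_series p (- m - n))"
proof -
  have "br (even_gen m a) (even_p n b) = even_p (m + n) (lie a b) +
      (\<Sum>k\<le>degree p. cent (coeff p k * (if (m + n) + int k = 0 then of_int m * form a b else 0)))"
    by (simp add: even_p_def br_sum_right br_simps br_gen(1) hat.scale_right_distrib
        sum.distrib gen_simps(6) add.assoc del: mult_zero_right)
  then show ?thesis
    by (simp only: cent_sum[symmetric] sum_coeff_delta) (simp add: mult.commute)
qed

text \<open>Both brackets are biadditive and the mode relations prescribe the same values on all
  pairs of generators.\<close>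

lemma br_unique:
  assumes "is_hat_bracket scale lie form scale1 iota p br'"
  shows "br' = br"
proof (intro ext)
  interpret other: hat_bracket_setting scale lie scale1 form iota p br'
    by unfold_locales fact
  fix X Y
  show "br' X Y = br X Y"
  proof (induction X rule: hat_induct)
    case (even m a)
    show ?case
      by (induction Y rule: hat_induct) (simp_all add: br_simps other.br_simps br_gen other.br_gen
          br_cent other.br_cent)
  next
    case (odd m a)
    show ?case
      by (induction Y rule: hat_induct) (simp_all add: br_simps other.br_simps br_gen other.br_gen
          br_cent other.br_cent)
  qed (simp_all add: br_simps other.br_simps br_cent other.br_cent)
qed

section \<open>The Lie algebra axioms\<close>

lemma form_commute: "form x y = form y x"
  using form_symmetric by (simp add: symmetric_form_def)

lemma br_skew_even_even: "br (even_gen m a) (even_gen n b) + br (even_gen n b) (even_gen m a) = 0"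
proof -
  let ?C = "(if m + n = 0 then of_int m * form a b else 0) +
    (if n + m = 0 then of_int n * form a b else 0)"
  have "br (even_gen m a) (even_gen n b) + br (even_gen n b) (even_gen m a) =
      even_gen (m + n) (lie a b + lie b a) + cent ?C"
    unfolding br_gen form_commute[of b a] gen_simps(1,5) by (simp add: add_ac)
  \<comment> \<open>On \<open>m + n = 0\<close> the two factors \<open>m\<close> and
    \<open>n\<close> are opposite; elsewhere both terms are zero.\<close>
  moreover have "?C = 0"
  proof (cases "m + n = 0")
    case True
    then have "m = - n" by simp
    then show ?thesis by simp
  qed (simp add: add.commute)
  ultimately show ?thesis by (simp only: lie_skew gen_simps add_0_left)
qed

lemma br_skew_even_odd: "br (even_gen m a) (odd_gen n b) + br (odd_gen n b) (even_gen m a) = 0"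
proof -
  have "br (even_gen m a) (odd_gen n b) + br (odd_gen n b) (even_gen m a) =
      odd_gen (m + n) (lie a b + lie b a)"
    by (simp add: br_gen gen_simps add.commute)
  then show ?thesis by (simp add: lie_skew gen_simps)
qed

text \<open>The factor (m - n)/2 changes sign under the exchange, while the form and p_{-m-n} are
  symmetric.\<close>

lemma br_skew_odd_odd: "br (odd_gen m a) (odd_gen n b) + br (odd_gen n b) (odd_gen m a) = 0"
proof -
  let ?P = "form a b * poly_series p (- m - n)"
  have "br (odd_gen m a) (odd_gen n b) + br (odd_gen n b) (odd_gen m a) =
      even_p (m + n) (lie a b + lie b a) +
      cent (of_int (m - n) / 2 * ?P + of_int (n - m) / 2 * ?P)"
    unfolding br_gen form_commute[of b a] gen_simps(5) gen_p_simps
    by (simp add: add_ac minus_diff_commute mult.assoc)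
  also have "of_int (m - n) / 2 * ?P + of_int (n - m) / 2 * ?P = 0"
    by (simp add: field_simps)
  finally show ?thesis by (simp add: lie_skew gen_simps gen_p_simps)
qed

lemma br_skew: "br X Y + br Y X = 0"
proof -
  \<comment> \<open>Both orders are recorded because the inductions on \<open>X\<close> and
    \<open>Y\<close> produce the sum on different sides.\<close>
  have add: "br (A + B) C + br C (A + B) = 0 \<and> br C (A + B) + br (A + B) C = 0"
    if "br A C + br C A = 0" "br B C + br C B = 0" for A B C
  proof -
    have "br (A + B) C + br C (A + B) = (br A C + br C A) + (br B C + br C B)"
      by (simp add: br_simps algebra_simps)
    then show ?thesis using that by (simp add: add.commute)
  qed
  show ?thesis
  proof (induction X rule: hat_induct)
    case (even m a)
    show ?case
      using br_skew_even_even br_skew_even_odd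
      by (induction Y rule: hat_induct) (auto simp: br_cent add add.commute)
  next
    case (odd m a)
    show ?case
      using br_skew_odd_odd br_skew_even_odd
      by (induction Y rule: hat_induct) (auto simp: br_cent add add.commute)
  qed (auto simp: add br_cent)
qed

text \<open>Skew symmetry gives 2[X,X] = 0, and 2 is invertible in the complex numbers.\<close>

lemma br_alternating: "br X X = 0"
proof -
  have "S 2 (br X X) = br X X + br X X"
    using hat.scale_left_distrib[of 1 1 "br X X"] by simp
  then have "S 2 (br X X) = 0" by (simp add: br_skew)
  then show ?thesis by simp
qed

section \<open>The Jacobi identity, by parity of the three arguments\<close>

definition jacobiator :: "('g, 'h) hat \<Rightarrow> ('g, 'h) hat \<Rightarrow> ('g, 'h) hat \<Rightarrow> ('g, 'h) hat" where
  "jacobiator X Y Z = br X (br Y Z) + br Y (br Z X) + br Z (br X Y)"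

text \<open>Rotation reduces the eight parity patterns of generators to four.\<close>

lemma jacobiator_cyclic: "jacobiator X Y Z = jacobiator Y Z X"
  by (simp add: jacobiator_def algebra_simps)

lemma jacobiator_add: "jacobiator (X + X') Y Z = jacobiator X Y Z + jacobiator X' Y Z"
  "jacobiator X (Y + Y') Z = jacobiator X Y Z + jacobiator X Y' Z"
  "jacobiator X Y (Z + Z') = jacobiator X Y Z + jacobiator X Y Z'"
  by (simp_all add: jacobiator_def br_simps algebra_simps)

lemma jacobiator_cent: "jacobiator (cent c) Y Z = 0" "jacobiator X (cent c) Z = 0"
  "jacobiator X Y (cent c) = 0"
  by (simp_all add: jacobiator_def br_cent br_0)

text \<open>The central terms add up to (l + m + n)<a,[b,c]> and occur only when l + m + n =
  0.\<close>

lemma jacobiator_even_even_even: "jacobiator (even_gen l a) (even_gen m b) (even_gen n c) = 0"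
proof -
  let ?F = "form a (lie b c)"
  let ?C = "(if l + (m + n) = 0 then of_int l * ?F else 0) +
    (if m + (n + l) = 0 then of_int m * ?F else 0) + (if n + (l + m) = 0 then of_int n * ?F else 0)"
  have "jacobiator (even_gen l a) (even_gen m b) (even_gen n c) =
      even_gen (l + m + n) (lie a (lie b c) + lie b (lie c a) + lie c (lie a b)) + cent ?C"
    unfolding jacobiator_def br_gen br_simps br_cent form_lie_cyclic[of b c a]
      form_lie_cyclic[of c a b] gen_simps(1,5)
    by (simp add: add_ac)
  moreover have "?C = 0"
  proof (cases "l + m + n = 0")
    case True
    then have "l = - (m + n)" by simp
    then show ?thesis by (simp add: distrib_right left_diff_distrib)
  qed (simp add: add_ac)
  ultimately show ?thesis by (simp only: jacobi gen_simps add_0_left)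
qed

text \<open>Each outer bracket pairs an even mode with an odd one, so no central term
  survives.\<close>

lemma jacobiator_even_even_odd: "jacobiator (even_gen l a) (even_gen m b) (odd_gen n c) = 0"
proof -
  have "jacobiator (even_gen l a) (even_gen m b) (odd_gen n c) =
      odd_gen (l + m + n) (lie a (lie b c) + lie b (lie c a) + lie c (lie a b))"
    unfolding jacobiator_def br_gen br_simps br_cent by (simp add: gen_simps add_ac)
  then show ?thesis by (simp add: jacobi gen_simps)
qed

lemma jacobiator_even_odd_odd: "jacobiator (even_gen l a) (odd_gen m b) (odd_gen n c) = 0"
proof -
  let ?P = "form a (lie b c) * poly_series p (- (l + m + n))"
  \<comment> \<open>All indices are brought to one form, so that the three central terms become
    multiples of \<open>?P\<close>; their factors l, (m - n - l)/2 and (n - l - m)/2 sum to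
    zero.\<close>
  have 1: "- l - (m + n) = - (l + m + n)" "- m - (n + l) = - (l + m + n)"
    "- n - (l + m) = - (l + m + n)" by auto
  have 2: "l + (m + n) = l + m + n" "m + (n + l) = l + m + n" "n + (l + m) = l + m + n" by auto
  have "jacobiator (even_gen l a) (odd_gen m b) (odd_gen n c) =
      even_p (l + m + n) (lie a (lie b c) + lie b (lie c a) + lie c (lie a b)) +
      cent (of_int l * ?P + of_int (m - (n + l)) / 2 * ?P + of_int (n - (l + m)) / 2 * ?P)"
    unfolding jacobiator_def br_gen br_simps br_cent br_even_even_p form_lie_cyclic[of b c a]
      form_lie_cyclic[of c a b] 1 2 gen_simps(5) gen_p_simps mult.assoc
    by (simp add: add_ac)
  also have "of_int l * ?P + of_int (m - (n + l)) / 2 * ?P + of_int (n - (l + m)) / 2 * ?P = 0"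
    by (simp add: field_simps)
  finally show ?thesis by (simp add: jacobi gen_simps gen_p_simps)
qed

lemma jacobiator_odd_odd_odd: "jacobiator (odd_gen l a) (odd_gen m b) (odd_gen n c) = 0"
proof -
  have "jacobiator (odd_gen l a) (odd_gen m b) (odd_gen n c) =
      odd_p (l + m + n) (lie a (lie b c) + lie b (lie c a) + lie c (lie a b))"
    unfolding jacobiator_def br_gen br_simps br_cent br_odd_even_p by (simp add: gen_p_simps add_ac)
  then show ?thesis by (simp add: jacobi gen_p_simps)
qed

text \<open>Triadditivity reduces the claim to generators: \<open>hat_induct\<close> is applied to
  \<open>Z\<close>, then \<open>Y\<close>, then \<open>X\<close>.\<close>

lemma jacobiator_eq_0: "jacobiator X Y Z = 0"
proof -
  have gens: "jacobiator (even_gen l a) (even_gen m b) (even_gen n c) = 0"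
    "jacobiator (even_gen l a) (even_gen m b) (odd_gen n c) = 0"
    "jacobiator (even_gen l a) (odd_gen m b) (even_gen n c) = 0"
    "jacobiator (even_gen l a) (odd_gen m b) (odd_gen n c) = 0"
    "jacobiator (odd_gen l a) (even_gen m b) (even_gen n c) = 0"
    "jacobiator (odd_gen l a) (even_gen m b) (odd_gen n c) = 0"
    "jacobiator (odd_gen l a) (odd_gen m b) (even_gen n c) = 0"
    "jacobiator (odd_gen l a) (odd_gen m b) (odd_gen n c) = 0" for l m n a b c
    by (metis jacobiator_cyclic jacobiator_even_even_even jacobiator_even_even_odd
        jacobiator_even_odd_odd jacobiator_odd_odd_odd)+
  have even_even: "jacobiator (even_gen l a) (even_gen m b) Z = 0" for l m a b
    by (induction Z rule: hat_induct) (simp_all add: jacobiator_add jacobiator_cent gens)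
  have even_odd: "jacobiator (even_gen l a) (odd_gen m b) Z = 0" for l m a b
    by (induction Z rule: hat_induct) (simp_all add: jacobiator_add jacobiator_cent gens)
  have odd_even: "jacobiator (odd_gen l a) (even_gen m b) Z = 0" for l m a b
    by (induction Z rule: hat_induct) (simp_all add: jacobiator_add jacobiator_cent gens)
  have odd_odd: "jacobiator (odd_gen l a) (odd_gen m b) Z = 0" for l m a b
    by (induction Z rule: hat_induct) (simp_all add: jacobiator_add jacobiator_cent gens)
  have even: "jacobiator (even_gen l a) Y Z = 0" for l a
    by (induction Y rule: hat_induct)
      (simp_all add: jacobiator_add jacobiator_cent even_even even_odd)
  have odd: "jacobiator (odd_gen l a) Y Z = 0" for l a
    by (induction Y rule: hat_induct)
      (simp_all add: jacobiator_add jacobiator_cent odd_even odd_odd)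
  show ?thesis
    by (induction X rule: hat_induct) (simp_all add: jacobiator_add jacobiator_cent even odd)
qed

lemma lie_algebra_br: "lie_algebra S br"
  using br_bilinear br_alternating jacobiator_eq_0
  by unfold_locales (simp_all add: jacobiator_def)

end

text \<open>Unique existence shows that the relations do define a bilinear operation, so the second
  conjunct is not vacuous.\<close>

theorem proposition3p7:
  fixes scale :: "complex \<Rightarrow> 'g::ab_group_add \<Rightarrow> 'g"
    and lie :: "'g \<Rightarrow> 'g \<Rightarrow> 'g"
    and form :: "'g \<Rightarrow> 'g \<Rightarrow> complex"
    and scale1 :: "complex \<Rightarrow> 'h::ab_group_add \<Rightarrow> 'h"
    and iota :: "'g \<Rightarrow> 'h"
    and p :: "complex poly"
  assumes "lie_algebra scale lie"
    and "bilinear_map scale scale (*) form"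
    and "symmetric_form form"
    and "invariant_form lie form"
    and "nondegenerate_form form"
    and "vector_space scale1"
    and "Vector_Spaces.linear scale scale1 iota"
    and "bij iota"
  shows "(\<exists>!br. is_hat_bracket scale lie form scale1 iota p br) \<and>
    (\<forall>br. is_hat_bracket scale lie form scale1 iota p br \<longrightarrow>
      lie_algebra (hat_scale scale scale1) br)"
proof -
  interpret hat_setting scale lie scale1 form iota p
    using assms by (simp add: hat_setting_def hat_setting_axioms_def)
  have setting: "hat_bracket_setting scale lie scale1 form iota p br"
    if "is_hat_bracket scale lie form scale1 iota p br" for br
    using that by unfold_locales
  show ?thesis
    using is_hat_bracket_hat_bracket hat_bracket_setting.br_unique[OF setting]
      hat_bracket_setting.lie_algebra_br[OF setting]
    by blast
qed

end
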